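(* There are precisely 93 $(\mathsf{J},\mathsf{SM})$-stable classes of Boolean functions, and they are the following (pairwise distinct) classes: \[ \begin{array}{l} \mathsf{\Omega},\ \mathsf{\Omega}_{\leq},\ \mathsf{\Omega}_{\geq},\ \mathsf{\Omega}_{\neq,00},\ \mathsf{\Omega}_{\neq,11},\\ \mathsf{\Omega}_{0*}\cup\mathsf{C},\ \mathsf{\Omega}_{*0}\cup\mathsf{C},\ \mathsf{\Omega}_{00}\cup\mathsf{C},\ \mathsf{\Omega}_{01}\cup\mathsf{C},\ \mathsf{\Omega}_{01}\cup\mathsf{C}_0,\ \mathsf{\Omega}_{01}\cup\mathsf{C}_1,\\ \mathsf{\Omega}_{1*}\cup\mathsf{C},\ \mathsf{\Omega}_{*1}\cup\mathsf{C},\ \mathsf{\Omega}_{11}\cup\mathsf{C},\ \mathsf{\Omega}_{10}\cup\mathsf{C},\ \mathsf{\Omega}_{10}\cup\mathsf{C}_1,\ \mathsf{\Omega}_{10}\cup\mathsf{C}_0,\\ \mathsf{\Omega}_{\neq},\ \mathsf{\Omega}_{=},\ \mathsf{\Omega}_{0*},\ \mathsf{\Omega}_{1*},\ \mathsf{\Omega}_{*0},\ \mathsf{\Omega}_{*1},\ \mathsf{\Omega}_{00},\ \mathsf{\Omega}_{11},\ \mathsf{\Omega}_{01},\ \mathsf{\Omega}_{10},\\ \mathsf{M},\ \mathsf{M}_{0*},\ \mathsf{M}_{*1},\ \mathsf{M}_{01},\ \overline{\mathsf{M}},\ \overline{\mathsf{M}}_{1*},\ \overline{\mathsf{M}}_{*0},\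 \overline{\mathsf{M}}_{10},\\ \mathsf{S}^-,\ \mathsf{S}^-_{\neq},\ \mathsf{S}^-_{0*},\ \mathsf{S}^-_{*0},\ \mathsf{S}^-_{01}\cup\mathsf{C}_0,\ \mathsf{S}^-_{10}\cup\mathsf{C}_0,\ \mathsf{S}^-_{01},\ \mathsf{S}^-_{10},\ \mathsf{S}^-_{00},\\ \mathsf{S}^+,\ \mathsf{S}^+_{\neq},\ \mathsf{S}^+_{1*},\ \mathsf{S}^+_{*1},\ \mathsf{S}^+_{10}\cup\mathsf{C}_1,\ \mathsf{S}^+_{01}\cup\mathsf{C}_1,\ \mathsf{S}^+_{10},\ \mathsf{S}^+_{01},\ \mathsf{S}^+_{11},\\ \mathsf{S},\ \mathsf{S}_{01},\ \mathsf{S}_{10},\ \mathsf{SM},\ \overline{\mathsf{SM}},\\ \mathsf{U}^2,\ \mathsf{U}^2_{01}\cup\mathsf{C}_0,\ \mathsf{U}^2_{01},\ \mathsf{MU}^2,\ \mathsf{MU}^2_{01},\ \mathsf{U}^2_{00},\\ \overline{\mathsf{U}^2},\ \overline{\mathsf{U}^2}_{10}\cup\mathsf{C}_1,\ \overline{\mathsf{U}^2}_{10},\ \overline{\mathsf{MU}^2},\ \overline{\mathsf{MU}^2}_{10},\ \overline{\mathsf{U}^2}_{11},\\ \mathsf{W}^2,\ \mathsf{W}^2_{01}\cup\mathsf{C}_1,\ \mathsf{W}^2_{01},\ \mathsf{MW}^2,\ \mathsf{MW}^2_{01},\ \mathsf{W}^2_{11},\\ \overline{\mathsf{W}^2},\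 \overline{\mathsf{W}^2}_{10}\cup\mathsf{C}_0,\ \overline{\mathsf{W}^2}_{10},\ \overline{\mathsf{MW}^2},\ \overline{\mathsf{MW}^2}_{10},\ \overline{\mathsf{W}^2}_{00},\\ \mathsf{U}^2\cap\overline{\mathsf{W}^2},\ \mathsf{W}^2\cap\overline{\mathsf{U}^2},\\ \mathsf{R},\ \mathsf{R}_{00}\cup\mathsf{C},\ \mathsf{R}_{11}\cup\mathsf{C},\ \mathsf{R}_{00},\ \mathsf{R}_{11},\ \mathsf{C},\ \mathsf{C}_0,\ \mathsf{C}_1,\ \emptyset. \end{array} \]
   Context: A Boolean function is a map $f\colon\{0,1\}^n\to\{0,1\}$ with $n\ge 1$; $\mathsf{\Omega}$ is the class of all Boolean functions (of all arities). The set $\{0,1\}^n$ is ordered componentwise, $\mathbf 0,\mathbf 1$ are the constant tuples, $\overline{\mathbf a}$ is the componentwise complement of $\mathbf a$, and $\wedge,\vee$ act componentwise on tuples. Stability. $\mathsf{J}$ is the clone of all projections on $\{0,1\}$. For $f$ $n$-ary and $\sigma\colon\{1,\dots,n\}\to\{1,\dots,m\}$, the function $f_\sigma(a_1,\dots,a_m):=f(a_{\sigma(1)},\dots,a_{\sigma(n)})$ is called a minor of $f$. $\mathsf{SM}$ is the clone of all self-dual monotone Boolean functions. A class $F\subseteq\mathsf{\Omega}$ is $(\mathsf{J},\mathsf{SM})$-stable if every minor of every member of $F$ is in $F$ (stability under right composition with $\mathsf{J}$), and $g(f_1,\dots,f_n)\in F$ whenever $g\in\mathsf{SM}$ is $n$-ary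 and $f_1,\dots,f_n\in F$ have the same arity (stability under left composition with $\mathsf{SM}$). Subclasses. For $C\subseteq\mathsf{\Omega}$ and $a,b\in\{0,1\}$: $C_{a*}=\{f\in C: f(\mathbf 0)=a\}$, $C_{*b}=\{f\in C: f(\mathbf 1)=b\}$, $C_{ab}=C_{a*}\cap C_{*b}$, $C_{=}=\{f\in C: f(\mathbf 0)=f(\mathbf 1)\}$, $C_{\neq}=\{f\in C: f(\mathbf 0)\neq f(\mathbf 1)\}$, $C_{\leq}=\{f\in C: f(\mathbf 0)\leq f(\mathbf 1)\}$, $C_{\geq}=\{f\in C: f(\mathbf 0)\geq f(\mathbf 1)\}$, $C_{\neq,00}=C_{\neq}\cup C_{00}$, $C_{\neq,11}=C_{\neq}\cup C_{11}$. The negation of $f$ is $\overline f(\mathbf a)=1-f(\mathbf a)$, and $\overline C=\{\overline f: f\in C\}$; a subscript on $\overline C$ is applied to the class $\overline C$ (e.g. $\overline{\mathsf M}_{1*}=\{f\in\overline{\mathsf M}: f(\mathbf 0)=1\}$). Named classes. $\mathsf{C}$: all constant functions; $\mathsf{C}_0,\mathsf{C}_1$: the constant functions with value $0$, resp. $1$. $\mathsf{M}$: monotone functions ($\mathbf a\le\mathbf b\Rightarrow f(\mathbf a)\le f(\mathbf b)$). $\mathsf{S}$: self-dual functions ($f(\overline{\mathbf a})=1-f(\mathbf a)$ for all $\mathbf a$); $\mathsf{SM}=\mathsf S\cap\mathsf M$. $\mathsf{R}$: reflexive functions ($f(\mathbf a)=f(\overline{\mathbf a})$ for all $\mathbf a$).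 $\mathsf{S}^-$ (resp. $\mathsf{S}^+$): functions $f$ that are pointwise $\le$ (resp. $\ge$) some self-dual function of the same arity; equivalently $f(\mathbf a)\wedge f(\overline{\mathbf a})=0$ (resp. $f(\mathbf a)\vee f(\overline{\mathbf a})=1$) for all $\mathbf a$. $\mathsf{U}^2$: functions such that $\mathbf a\wedge\mathbf b\neq\mathbf 0$ for all (not necessarily distinct) $\mathbf a,\mathbf b\in f^{-1}(1)$. $\mathsf{W}^2$: functions such that $\mathbf a\vee\mathbf b\neq\mathbf 1$ for all (not necessarily distinct) $\mathbf a,\mathbf b\in f^{-1}(0)$. $\mathsf{MU}^2=\mathsf M\cap\mathsf U^2$, $\mathsf{MW}^2=\mathsf M\cap\mathsf W^2$. *)

theory Defs
  imports Main "HOL-Library.FuncSet"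
begin

text \<open>
  The set \<open>{0,1}\<close> is \<^typ>\<open>bool\<close> with its standard order. Tuples are lists, so positions are counted
  from 0. A Boolean function is a pair of its arity \<open>n\<close> and a map on the lists of length \<open>n\<close>;
  the map is extensional, so that equality of pairs is equality of Boolean functions.
\<close>

type_synonym boolfun = "nat \<times> (bool list \<Rightarrow> bool)"

definition cube :: "nat \<Rightarrow> bool list set" where
  "cube n = {a. length a = n}"

definition Omega :: "boolfun set" ("\<Omega>") where
  "\<Omega> = {(n, f). n \<ge> 1 \<and> f \<in> cube n \<rightarrow>\<^sub>E UNIV}"

definition tuple_le :: "bool list \<Rightarrow> bool list \<Rightarrow> bool" where
  "tuple_le a b \<longleftrightarrow> list_all2 (\<le>) a b"

definition tuple_compl :: "bool list \<Rightarrow> bool list" where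
  "tuple_compl a = map Not a"

definition tuple_meet :: "bool list \<Rightarrow> bool list \<Rightarrow> bool list" where
  "tuple_meet a b = map2 (\<and>) a b"

definition tuple_join :: "bool list \<Rightarrow> bool list \<Rightarrow> bool list" where
  "tuple_join a b = map2 (\<or>) a b"

abbreviation zeros :: "nat \<Rightarrow> bool list" where
  "zeros n \<equiv> replicate n False"

abbreviation ones :: "nat \<Rightarrow> bool list" where
  "ones n \<equiv> replicate n True"


subsection \<open>Named classes\<close>

definition Const_val :: "bool \<Rightarrow> boolfun set" where
  "Const_val c = {(n, f) \<in> \<Omega>. \<forall>a \<in> cube n. f a = c}"

abbreviation Const0 ("\<C>\<^sub>0") where "\<C>\<^sub>0 \<equiv> Const_val False"
abbreviation Const1 ("\<C>\<^sub>1") where "\<C>\<^sub>1 \<equiv> Const_val True"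

definition Const :: "boolfun set" ("\<C>") where
  "\<C> = {(n, f) \<in> \<Omega>. \<exists>c. \<forall>a \<in> cube n. f a = c}"

definition Monotone :: "boolfun set" ("\<M>") where
  "\<M> = {(n, f) \<in> \<Omega>. \<forall>a \<in> cube n. \<forall>b \<in> cube n. tuple_le a b \<longrightarrow> f a \<le> f b}"

definition Selfdual :: "boolfun set" ("\<S>") where
  "\<S> = {(n, f) \<in> \<Omega>. \<forall>a \<in> cube n. f (tuple_compl a) = (\<not> f a)}"

definition Selfdual_Monotone :: "boolfun set" ("\<S>\<M>") where
  "\<S>\<M> = \<S> \<inter> \<M>"

definition Reflexive :: "boolfun set" ("\<R>") where
  "\<R> = {(n, f) \<in> \<Omega>. \<forall>a \<in> cube n. f a = f (tuple_compl a)}"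

definition Sminus :: "boolfun set" ("\<S>\<^sup>-") where
  "\<S>\<^sup>- = {(n, f) \<in> \<Omega>. \<exists>g. (n, g) \<in> \<S> \<and> (\<forall>a \<in> cube n. f a \<le> g a)}"

definition Splus :: "boolfun set" ("\<S>\<^sup>+") where
  "\<S>\<^sup>+ = {(n, f) \<in> \<Omega>. \<exists>g. (n, g) \<in> \<S> \<and> (\<forall>a \<in> cube n. f a \<ge> g a)}"

definition U2 :: "boolfun set" ("\<U>\<^sup>2") where
  "\<U>\<^sup>2 = {(n, f) \<in> \<Omega>. \<forall>a \<in> cube n. \<forall>b \<in> cube n. f a \<and> f b \<longrightarrow> tuple_meet a b \<noteq> zeros n}"

definition W2 :: "boolfun set" ("\<W>\<^sup>2") where
  "\<W>\<^sup>2 = {(n, f) \<in> \<Omega>. \<forall>a \<in> cube n. \<forall>b \<in> cube n. \<not> f a \<and> \<not> f b \<longrightarrow> tuple_join a b \<noteq> ones n}"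

definition MU2 :: "boolfun set" ("\<M>\<U>\<^sup>2") where
  "\<M>\<U>\<^sup>2 = \<M> \<inter> \<U>\<^sup>2"

definition MW2 :: "boolfun set" ("\<M>\<W>\<^sup>2") where
  "\<M>\<W>\<^sup>2 = \<M> \<inter> \<W>\<^sup>2"


subsection \<open>Subclasses and negated classes\<close>

definition val_zeros :: "boolfun set \<Rightarrow> bool \<Rightarrow> boolfun set" where
  "val_zeros C a = {(n, f) \<in> C. f (zeros n) = a}"

definition val_ones :: "boolfun set \<Rightarrow> bool \<Rightarrow> boolfun set" where
  "val_ones C b = {(n, f) \<in> C. f (ones n) = b}"

definition val_both :: "boolfun set \<Rightarrow> bool \<Rightarrow> bool \<Rightarrow> boolfun set" where
  "val_both C a b = val_zeros C a \<inter> val_ones C b"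

abbreviation sub_0x ("_\<^bsub>0*\<^esub>" [1000] 1000) where "C\<^bsub>0*\<^esub> \<equiv> val_zeros C False"
abbreviation sub_1x ("_\<^bsub>1*\<^esub>" [1000] 1000) where "C\<^bsub>1*\<^esub> \<equiv> val_zeros C True"
abbreviation sub_x0 ("_\<^bsub>*0\<^esub>" [1000] 1000) where "C\<^bsub>*0\<^esub> \<equiv> val_ones C False"
abbreviation sub_x1 ("_\<^bsub>*1\<^esub>" [1000] 1000) where "C\<^bsub>*1\<^esub> \<equiv> val_ones C True"
abbreviation sub_00 ("_\<^bsub>00\<^esub>" [1000] 1000) where "C\<^bsub>00\<^esub> \<equiv> val_both C False False"
abbreviation sub_01 ("_\<^bsub>01\<^esub>" [1000] 1000) where "C\<^bsub>01\<^esub> \<equiv> val_both C False True"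
abbreviation sub_10 ("_\<^bsub>10\<^esub>" [1000] 1000) where "C\<^bsub>10\<^esub> \<equiv> val_both C True False"
abbreviation sub_11 ("_\<^bsub>11\<^esub>" [1000] 1000) where "C\<^bsub>11\<^esub> \<equiv> val_both C True True"

definition sub_eq :: "boolfun set \<Rightarrow> boolfun set" ("_\<^bsub>=\<^esub>" [1000] 1000) where
  "C\<^bsub>=\<^esub> = {(n, f) \<in> C. f (zeros n) = f (ones n)}"

definition sub_neq :: "boolfun set \<Rightarrow> boolfun set" ("_\<^bsub>\<noteq>\<^esub>" [1000] 1000) where
  "C\<^bsub>\<noteq>\<^esub> = {(n, f) \<in> C. f (zeros n) \<noteq> f (ones n)}"

definition sub_le :: "boolfun set \<Rightarrow> boolfun set" ("_\<^bsub>\<le>\<^esub>" [1000] 1000) where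
  "C\<^bsub>\<le>\<^esub> = {(n, f) \<in> C. f (zeros n) \<le> f (ones n)}"

definition sub_ge :: "boolfun set \<Rightarrow> boolfun set" ("_\<^bsub>\<ge>\<^esub>" [1000] 1000) where
  "C\<^bsub>\<ge>\<^esub> = {(n, f) \<in> C. f (zeros n) \<ge> f (ones n)}"

definition sub_neq_00 :: "boolfun set \<Rightarrow> boolfun set" ("_\<^bsub>\<noteq>,00\<^esub>" [1000] 1000) where
  "C\<^bsub>\<noteq>,00\<^esub> = C\<^bsub>\<noteq>\<^esub> \<union> C\<^bsub>00\<^esub>"

definition sub_neq_11 :: "boolfun set \<Rightarrow> boolfun set" ("_\<^bsub>\<noteq>,11\<^esub>" [1000] 1000) where
  "C\<^bsub>\<noteq>,11\<^esub> = C\<^bsub>\<noteq>\<^esub> \<union> C\<^bsub>11\<^esub>"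

definition negation :: "boolfun \<Rightarrow> boolfun" where
  "negation = (\<lambda>(n, f). (n, \<lambda>a \<in> cube n. \<not> f a))"

definition neg :: "boolfun set \<Rightarrow> boolfun set" where
  "neg C = negation ` C"


subsection \<open>Stability\<close>

text \<open>\<open>minor m \<sigma> (n, f)\<close> is the \<open>m\<close>-ary minor of the \<open>n\<close>-ary \<open>f\<close> along \<open>\<sigma> : {0..<n} \<rightarrow> {0..<m}\<close>.\<close>

definition minor :: "nat \<Rightarrow> (nat \<Rightarrow> nat) \<Rightarrow> boolfun \<Rightarrow> boolfun" where
  "minor m \<sigma> = (\<lambda>(n, f). (m, \<lambda>a \<in> cube m. f (map (\<lambda>i. a ! \<sigma> i) [0..<n])))"

definition minor_closed :: "boolfun set \<Rightarrow> bool" where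
  "minor_closed F \<longleftrightarrow>
     (\<forall>n f m \<sigma>. (n, f) \<in> F \<and> m \<ge> 1 \<and> \<sigma> \<in> {0..<n} \<rightarrow> {0..<m} \<longrightarrow> minor m \<sigma> (n, f) \<in> F)"

text \<open>\<open>compose (n, g) m fs\<close> is the \<open>m\<close>-ary function \<open>g(fs 0, \<dots>, fs (n - 1))\<close>.\<close>

definition compose :: "boolfun \<Rightarrow> nat \<Rightarrow> (nat \<Rightarrow> bool list \<Rightarrow> bool) \<Rightarrow> boolfun" where
  "compose = (\<lambda>(n, g) m fs. (m, \<lambda>a \<in> cube m. g (map (\<lambda>i. fs i a) [0..<n])))"

definition left_closed :: "boolfun set \<Rightarrow> boolfun set \<Rightarrow> bool" where
  "left_closed G F \<longleftrightarrow>
     (\<forall>n g m fs. (n, g) \<in> G \<and> (\<forall>i<n. (m, fs i) \<in> F) \<longrightarrow> compose (n, g) m fs \<in> F)"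

definition J_SM_stable :: "boolfun set \<Rightarrow> bool" where
  "J_SM_stable F \<longleftrightarrow> F \<subseteq> \<Omega> \<and> minor_closed F \<and> left_closed \<S>\<M> F"

definition stable_class_list :: "boolfun set list" where
  "stable_class_list =
    [\<Omega>, \<Omega>\<^bsub>\<le>\<^esub>, \<Omega>\<^bsub>\<ge>\<^esub>, \<Omega>\<^bsub>\<noteq>,00\<^esub>, \<Omega>\<^bsub>\<noteq>,11\<^esub>,
     \<Omega>\<^bsub>0*\<^esub> \<union> \<C>, \<Omega>\<^bsub>*0\<^esub> \<union> \<C>, \<Omega>\<^bsub>00\<^esub> \<union> \<C>, \<Omega>\<^bsub>01\<^esub> \<union> \<C>, \<Omega>\<^bsub>01\<^esub> \<union> \<C>\<^sub>0, \<Omega>\<^bsub>01\<^esub> \<union> \<C>\<^sub>1,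
     \<Omega>\<^bsub>1*\<^esub> \<union> \<C>, \<Omega>\<^bsub>*1\<^esub> \<union> \<C>, \<Omega>\<^bsub>11\<^esub> \<union> \<C>, \<Omega>\<^bsub>10\<^esub> \<union> \<C>, \<Omega>\<^bsub>10\<^esub> \<union> \<C>\<^sub>1, \<Omega>\<^bsub>10\<^esub> \<union> \<C>\<^sub>0,
     \<Omega>\<^bsub>\<noteq>\<^esub>, \<Omega>\<^bsub>=\<^esub>, \<Omega>\<^bsub>0*\<^esub>, \<Omega>\<^bsub>1*\<^esub>, \<Omega>\<^bsub>*0\<^esub>, \<Omega>\<^bsub>*1\<^esub>, \<Omega>\<^bsub>00\<^esub>, \<Omega>\<^bsub>11\<^esub>, \<Omega>\<^bsub>01\<^esub>, \<Omega>\<^bsub>10\<^esub>,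
     \<M>, \<M>\<^bsub>0*\<^esub>, \<M>\<^bsub>*1\<^esub>, \<M>\<^bsub>01\<^esub>, neg \<M>, (neg \<M>)\<^bsub>1*\<^esub>, (neg \<M>)\<^bsub>*0\<^esub>, (neg \<M>)\<^bsub>10\<^esub>,
     \<S>\<^sup>-, \<S>\<^sup>-\<^bsub>\<noteq>\<^esub>, \<S>\<^sup>-\<^bsub>0*\<^esub>, \<S>\<^sup>-\<^bsub>*0\<^esub>, \<S>\<^sup>-\<^bsub>01\<^esub> \<union> \<C>\<^sub>0, \<S>\<^sup>-\<^bsub>10\<^esub> \<union> \<C>\<^sub>0, \<S>\<^sup>-\<^bsub>01\<^esub>, \<S>\<^sup>-\<^bsub>10\<^esub>, \<S>\<^sup>-\<^bsub>00\<^esub>,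
     \<S>\<^sup>+, \<S>\<^sup>+\<^bsub>\<noteq>\<^esub>, \<S>\<^sup>+\<^bsub>1*\<^esub>, \<S>\<^sup>+\<^bsub>*1\<^esub>, \<S>\<^sup>+\<^bsub>10\<^esub> \<union> \<C>\<^sub>1, \<S>\<^sup>+\<^bsub>01\<^esub> \<union> \<C>\<^sub>1, \<S>\<^sup>+\<^bsub>10\<^esub>, \<S>\<^sup>+\<^bsub>01\<^esub>, \<S>\<^sup>+\<^bsub>11\<^esub>,
     \<S>, \<S>\<^bsub>01\<^esub>, \<S>\<^bsub>10\<^esub>, \<S>\<M>, neg \<S>\<M>,
     \<U>\<^sup>2, \<U>\<^sup>2\<^bsub>01\<^esub> \<union> \<C>\<^sub>0, \<U>\<^sup>2\<^bsub>01\<^esub>, \<M>\<U>\<^sup>2, \<M>\<U>\<^sup>2\<^bsub>01\<^esub>, \<U>\<^sup>2\<^bsub>00\<^esub>,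
     neg \<U>\<^sup>2, (neg \<U>\<^sup>2)\<^bsub>10\<^esub> \<union> \<C>\<^sub>1, (neg \<U>\<^sup>2)\<^bsub>10\<^esub>, neg \<M>\<U>\<^sup>2, (neg \<M>\<U>\<^sup>2)\<^bsub>10\<^esub>, (neg \<U>\<^sup>2)\<^bsub>11\<^esub>,
     \<W>\<^sup>2, \<W>\<^sup>2\<^bsub>01\<^esub> \<union> \<C>\<^sub>1, \<W>\<^sup>2\<^bsub>01\<^esub>, \<M>\<W>\<^sup>2, \<M>\<W>\<^sup>2\<^bsub>01\<^esub>, \<W>\<^sup>2\<^bsub>11\<^esub>,
     neg \<W>\<^sup>2, (neg \<W>\<^sup>2)\<^bsub>10\<^esub> \<union> \<C>\<^sub>0, (neg \<W>\<^sup>2)\<^bsub>10\<^esub>, neg \<M>\<W>\<^sup>2, (neg \<M>\<W>\<^sup>2)\<^bsub>10\<^esub>, (neg \<W>\<^sup>2)\<^bsub>00\<^esub>,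
     \<U>\<^sup>2 \<inter> neg \<W>\<^sup>2, \<W>\<^sup>2 \<inter> neg \<U>\<^sup>2,
     \<R>, \<R>\<^bsub>00\<^esub> \<union> \<C>, \<R>\<^bsub>11\<^esub> \<union> \<C>, \<R>\<^bsub>00\<^esub>, \<R>\<^bsub>11\<^esub>, \<C>, \<C>\<^sub>0, \<C>\<^sub>1, {}]"

end

theory Submission
  imports Defs
begin

text \<open>
  Since the majority function is in \<open>\<S>\<M>\<close>, the argument of Baker and Pixley shows that a stable
  class \<open>F\<close> is determined by the sets of values \<open>(f a, f b)\<close>, \<open>f \<in> F\<close>, at pairs of tuples, and by
  closure under minors such a set depends only on the set of columns \<open>(a\<^sub>i, b\<^sub>i)\<close>. So \<open>F\<close> amounts to a
  family of binary relations on \<open>{0,1}\<close> indexed by the sets of columns. The family is monotone in the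
  index, and it is path consistent: a pair of values at \<open>(a, b)\<close> extends to any third tuple. Only 93
  families meet a few instances of these two conditions, which bounds the number of stable classes.

  Conversely, a class given by binary constraints is stable because self-dual monotone functions
  preserve all binary relations on \<open>{0,1}\<close>. All listed classes are of this form, and some ternary
  functions tell them apart.
\<close>

section \<open>Binary relations on the two-element set\<close>

text \<open>The fields tell whether 00, 01, 10, 11 belong to the relation. With four Booleans
  instead of a predicate, inclusion and composition can be evaluated, as the enumerations below
  require.\<close>

datatype brel = Rel bool bool bool bool

definition rel_of :: "(bool \<Rightarrow> bool \<Rightarrow> bool) \<Rightarrow> brel" where
  "rel_of p = Rel (p False False) (p False True) (p True False) (p True True)"

fun mem :: "brel \<Rightarrow> bool \<Rightarrow> bool \<Rightarrow> bool" where
  "mem (Rel p q r s) False False = p"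
| "mem (Rel p q r s) False True = q"
| "mem (Rel p q r s) True False = r"
| "mem (Rel p q r s) True True = s"

fun rel_le :: "brel \<Rightarrow> brel \<Rightarrow> bool" (infix "\<sqsubseteq>" 50) where
  "Rel p q r s \<sqsubseteq> Rel p' q' r' s' \<longleftrightarrow> (p \<longrightarrow> p') \<and> (q \<longrightarrow> q') \<and> (r \<longrightarrow> r') \<and> (s \<longrightarrow> s')"

fun rel_conv :: "brel \<Rightarrow> brel" where
  "rel_conv (Rel p q r s) = Rel p r q s"

fun rel_comp :: "brel \<Rightarrow> brel \<Rightarrow> brel" (infixl "\<odot>" 70) where
  "Rel p q r s \<odot> Rel p' q' r' s' =
     Rel (p \<and> p' \<or> q \<and> r') (p \<and> q' \<or> q \<and> s') (r \<and> p' \<or> s \<and> r') (r \<and> q' \<or> s \<and> s')"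

text \<open>Both entries of each pair are negated; this is not the complement of the
  relation.\<close>

fun neg_rel :: "brel \<Rightarrow> brel" where
  "neg_rel (Rel p q r s) = Rel s r q p"

text \<open>The identity restricted to the domain; it appears when a tuple is paired with
  itself.\<close>

fun diag_dom :: "brel \<Rightarrow> brel" where
  "diag_dom (Rel p q r s) = Rel (p \<or> q) False False (r \<or> s)"

lemma mem_rel_of [simp]: "mem (rel_of p) x y = p x y"
  by (cases x; cases y) (simp_all add: rel_of_def)

lemma mem_Rel: "mem (Rel p q r s) x y = (if x then if y then s else r else if y then q else p)"
  by (cases x; cases y) simp_all

lemma rel_le_iff: "r \<sqsubseteq> s \<longleftrightarrow> (\<forall>x y. mem r x y \<longrightarrow> mem s x y)"
  by (cases r; cases s) (auto simp: all_bool_eq)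

lemma rel_eq_iff: "r = s \<longleftrightarrow> (\<forall>x y. mem r x y \<longleftrightarrow> mem s x y)"
  by (cases r; cases s) (auto simp: all_bool_eq)

lemma mem_rel_conv [simp]: "mem (rel_conv r) x y = mem r y x"
  by (cases r) (simp add: mem_Rel)

lemma mem_rel_comp: "mem (r \<odot> s) x y \<longleftrightarrow> (\<exists>z. mem r x z \<and> mem s z y)"
  by (cases r; cases s; cases x; cases y) (simp_all add: ex_bool_eq disj_commute)

lemma mem_neg_rel: "mem (neg_rel r) (\<not> x) (\<not> y) = mem r x y"
  by (cases r) (simp add: mem_Rel)

lemma mem_diag_dom: "mem (diag_dom r) x y \<longleftrightarrow> x = y \<and> (\<exists>z. mem r x z)"
  by (cases r; cases x; cases y) (simp_all add: ex_bool_eq disj_commute)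

section \<open>Column types and constraints\<close>

definition cols :: "bool list \<Rightarrow> bool list \<Rightarrow> brel" where
  "cols a b = rel_of (\<lambda>x y. (x, y) \<in> set (zip a b))"

lemma mem_cols:
  assumes "a \<in> cube n" "b \<in> cube n"
  shows "mem (cols a b) x y \<longleftrightarrow> (\<exists>i<n. a ! i = x \<and> b ! i = y)"
  using assms by (auto simp: cols_def cube_def set_zip)

lemma cols_le:
  assumes "a \<in> cube n" "b \<in> cube n"
  shows "cols a b \<sqsubseteq> t \<longleftrightarrow> (\<forall>i<n. mem t (a ! i) (b ! i))"
  using assms by (auto simp: rel_le_iff mem_cols)

lemma conv_cols: "length a = length b \<Longrightarrow> rel_conv (cols a b) = cols b a"
  by (auto simp: rel_eq_iff mem_cols[of _ "length b"] cube_def)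

text \<open>In a constraint \<open>(T, R)\<close>, \<open>T\<close> bounds the set of columns of a pair of tuples, and \<open>R\<close> the
  pair of values at these tuples.\<close>

definition constrained :: "(brel \<times> brel) list \<Rightarrow> boolfun set" where
  "constrained cs = {(n, f) \<in> \<Omega>. \<forall>(T, R) \<in> set cs. \<forall>a \<in> cube n. \<forall>b \<in> cube n.
     cols a b \<sqsubseteq> T \<longrightarrow> mem R (f a) (f b)}"

text \<open>Reindexing only selects columns of \<open>(a, b)\<close>, so the column set can shrink
  but not grow. A constraint covers all column sets below its bound for this reason.\<close>

lemma minor_tuple:
  assumes "a \<in> cube m" "b \<in> cube m" "\<sigma> \<in> {0..<n} \<rightarrow> {0..<m}"
  shows "map (\<lambda>i. a ! \<sigma> i) [0..<n] \<in> cube n"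
    and "cols (map (\<lambda>i. a ! \<sigma> i) [0..<n]) (map (\<lambda>i. b ! \<sigma> i) [0..<n]) \<sqsubseteq> cols a b"
proof -
  show "map (\<lambda>i. a ! \<sigma> i) [0..<n] \<in> cube n" by (simp add: cube_def)
  show "cols (map (\<lambda>i. a ! \<sigma> i) [0..<n]) (map (\<lambda>i. b ! \<sigma> i) [0..<n]) \<sqsubseteq> cols a b"
    using assms by (subst cols_le[of _ n]) (auto simp: cube_def mem_cols[of _ m] Pi_iff)
qed

lemma rel_le_refl: "r \<sqsubseteq> r"
  by (simp add: rel_le_iff)

lemma rel_le_trans: "r \<sqsubseteq> s \<Longrightarrow> s \<sqsubseteq> t \<Longrightarrow> r \<sqsubseteq> t"
  by (auto simp: rel_le_iff)

text \<open>Every binary relation on \<open>{0,1}\<close> is an intersection of two-literal clauses, and each of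
  these is preserved by a self-dual monotone function.\<close>

lemma SM_preserves:
  assumes g: "(n, g) \<in> \<S>\<M>" and u: "u \<in> cube n" "v \<in> cube n"
    and R: "\<And>i. i < n \<Longrightarrow> mem R (u ! i) (v ! i)"
  shows "mem R (g u) (g v)"
proof (rule ccontr)
  assume contr: "\<not> mem R (g u) (g v)"
  have mono: "g a \<longrightarrow> g b" if "a \<in> cube n" "b \<in> cube n" "\<And>i. i < n \<Longrightarrow> a ! i \<longrightarrow> b ! i" for a b
    using g that by (auto simp: Selfdual_Monotone_def Monotone_def tuple_le_def cube_def list_all2_conv_all_nth)
  have dual: "g (map Not a) = (\<not> g a)" if "a \<in> cube n" for a
    using g that by (auto simp: Selfdual_Monotone_def Selfdual_def tuple_compl_def)
  have nu: "map Not u \<in> cube n" "map Not v \<in> cube n" "length u = n" "length v = n"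
    using u by (auto simp: cube_def)
  \<comment> \<open>No column equals the missing pair \<open>(g u, g v)\<close>, so all columns
    satisfy the two-literal clause excluding it. If \<open>g u = g v\<close>, the clause compares
    \<open>v\<close> with the complement of \<open>u\<close>; otherwise it compares \<open>u\<close>
    with \<open>v\<close>. Monotonicity, with duality in the first case, gives the
    contradiction.\<close>
  have ne: "u ! i \<noteq> g u \<or> v ! i \<noteq> g v" if "i < n" for i
    using R[OF that] contr by (cases "u ! i = g u"; cases "v ! i = g v") simp_all
  show False
  proof (cases "g u = g v")
    case True
    show False
    proof (cases "g u")
      case True
      with \<open>g u = g v\<close> have "g v \<longrightarrow> g (map Not u)" using u nu ne by (intro mono) auto
      with True \<open>g u = g v\<close> dual[OF u(1)] show False by simp
    next
      case False
      with \<open>g u = g v\<close> have "g (map Not u) \<longrightarrow> g v" using u nu ne by (intro mono) auto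
      with False \<open>g u = g v\<close> dual[OF u(1)] show False by simp
    qed
  next
    case False
    show False
    proof (cases "g u")
      case True
      with False have "g u \<longrightarrow> g v" using u ne by (intro mono) auto
      with True False show False by simp
    next
      case False
      with \<open>g u \<noteq> g v\<close> have "g v \<longrightarrow> g u" using u ne by (intro mono) auto
      with False \<open>g u \<noteq> g v\<close> show False by simp
    qed
  qed
qed

text \<open>Reindexing stays below every column bound, and outer functions from
  \<open>\<S>\<M>\<close> preserve every value relation. This settles the stability of all listed
  classes at once.\<close>

lemma constrained_stable: "J_SM_stable (constrained cs)"
  unfolding J_SM_stable_def
proof (intro conjI)
  show "constrained cs \<subseteq> \<Omega>" by (auto simp: constrained_def)
  show "minor_closed (constrained cs)"
    unfolding minor_closed_def
  proof (intro allI impI, elim conjE)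
    fix n f m and \<sigma> :: "nat \<Rightarrow> nat"
    assume f: "(n, f) \<in> constrained cs" and m: "1 \<le> m" and s: "\<sigma> \<in> {0..<n} \<rightarrow> {0..<m}"
    have "mem R (f (map (\<lambda>i. a ! \<sigma> i) [0..<n])) (f (map (\<lambda>i. b ! \<sigma> i) [0..<n]))"
      if "(T, R) \<in> set cs" "a \<in> cube m" "b \<in> cube m" "cols a b \<sqsubseteq> T" for T R a b
      using f minor_tuple(1)[OF that(2,2) s] minor_tuple(1)[OF that(3,3) s] that(1)
        rel_le_trans[OF minor_tuple(2)[OF that(2,3) s] that(4)]
      unfolding constrained_def by blast
    thus "minor m \<sigma> (n, f) \<in> constrained cs"
      using m by (auto simp: constrained_def minor_def Omega_def)
  qed
  show "left_closed \<S>\<M> (constrained cs)"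
    unfolding left_closed_def
  proof (intro allI impI, elim conjE)
    fix n g m fs
    assume g: "(n, g) \<in> \<S>\<M>" and fs: "\<forall>i<n. (m, fs i) \<in> constrained cs"
    have n: "n \<ge> 1" using g by (auto simp: Selfdual_Monotone_def Monotone_def Omega_def)
    hence m: "m \<ge> 1" using fs by (auto simp: constrained_def Omega_def dest!: spec[of _ 0])
    have "mem R (g (map (\<lambda>i. fs i a) [0..<n])) (g (map (\<lambda>i. fs i b) [0..<n]))"
      if "(T, R) \<in> set cs" "a \<in> cube m" "b \<in> cube m" "cols a b \<sqsubseteq> T" for T R a b
    proof (rule SM_preserves[OF g])
      fix i assume "i < n"
      with fs have "(m, fs i) \<in> constrained cs" by simp
      with that have "mem R (fs i a) (fs i b)" unfolding constrained_def by blast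
      with \<open>i < n\<close> show "mem R (map (\<lambda>i. fs i a) [0..<n] ! i) (map (\<lambda>i. fs i b) [0..<n] ! i)" by simp
    qed (simp_all add: cube_def)
    thus "compose (n, g) m fs \<in> constrained cs"
      using m by (auto simp: constrained_def compose_def Omega_def)
  qed
qed

section \<open>The signature of a stable class\<close>

text \<open>Members of all arities contribute; for a class closed under minors nothing is lost, by
  \<open>sig_transport\<close>.\<close>

definition sig :: "boolfun set \<Rightarrow> brel \<Rightarrow> brel" where
  "sig F t = rel_of (\<lambda>x y. \<exists>n f a b. (n, f) \<in> F \<and> a \<in> cube n \<and> b \<in> cube n \<and>
     cols a b = t \<and> f a = x \<and> f b = y)"

lemma sigI: "(n, f) \<in> F \<Longrightarrow> a \<in> cube n \<Longrightarrow> b \<in> cube n \<Longrightarrow> mem (sig F (cols a b)) (f a) (f b)"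
  by (auto simp: sig_def)

text \<open>Each column of the witnessing pair \<open>(a', b')\<close> occurs in
  \<open>(a, b)\<close>; sending every position to one with the same column gives a \<sigma> whose
  minor takes the old values at \<open>(a, b)\<close>.\<close>

lemma sig_transport:
  assumes F: "minor_closed F" and t: "mem (sig F t) x y" "t \<sqsubseteq> cols a b"
    and ab: "a \<in> cube m" "b \<in> cube m" "m \<ge> 1"
  obtains g where "(m, g) \<in> F" "g a = x" "g b = y"
proof -
  from t(1) obtain n f a' b' where f: "(n, f) \<in> F" "a' \<in> cube n" "b' \<in> cube n"
    and eq: "cols a' b' = t" "f a' = x" "f b' = y" by (auto simp: sig_def)
  have "\<exists>j<m. a ! j = a' ! i \<and> b ! j = b' ! i" if "i < n" for i
    using t(2) f that ab unfolding eq(1)[symmetric] by (simp add: cols_le mem_cols[of _ m])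
  then obtain \<sigma> where s: "\<And>i. i < n \<Longrightarrow> \<sigma> i < m \<and> a ! \<sigma> i = a' ! i \<and> b ! \<sigma> i = b' ! i" by metis
  have "map (\<lambda>i. a ! \<sigma> i) [0..<n] = a'" "map (\<lambda>i. b ! \<sigma> i) [0..<n] = b'"
    using s f by (auto simp: cube_def intro!: nth_equalityI)
  moreover have "minor m \<sigma> (n, f) \<in> F"
    using F f(1) ab(3) s by (auto simp: minor_closed_def Pi_iff)
  ultimately show thesis using that eq ab by (auto simp: minor_def)
qed

text \<open>The pairs of \<open>t\<close>, each listed once, serve as the columns.\<close>

lemma ex_cols:
  assumes "mem t x y"
  shows "\<exists>a b m. a \<in> cube m \<and> b \<in> cube m \<and> m \<ge> 1 \<and> cols a b = t"
proof -
  define u where "u = filter (\<lambda>(x, y). mem t x y) [(False, False), (False, True), (True, False), (True, True)]"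
  have u: "(x, y) \<in> set u \<longleftrightarrow> mem t x y" for x y
    by (cases x; cases y) (simp_all add: u_def del: filter.simps)
  from assms have "u \<noteq> []" unfolding u[symmetric] by auto
  moreover have "cols (map fst u) (map snd u) = t"
    by (simp add: rel_eq_iff cols_def zip_map_fst_snd u)
  ultimately show ?thesis
    by (intro exI[of _ "map fst u"] exI[of _ "map snd u"] exI[of _ "length u"])
      (simp add: cube_def Suc_le_eq)
qed

text \<open>A witness at \<open>t\<close> is transported to a pair of tuples with column set
  \<open>t'\<close>; if \<open>t'\<close> is empty, so is \<open>t\<close>.\<close>

lemma sig_mono:
  assumes "minor_closed F" "t \<sqsubseteq> t'"
  shows "sig F t \<sqsubseteq> sig F t'"
  unfolding rel_le_iff
proof (intro allI impI)
  fix x y assume xy: "mem (sig F t) x y"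
  show "mem (sig F t') x y"
  proof (cases "\<exists>x y. mem t' x y")
    case True
    then obtain a b m where ab: "a \<in> cube m" "b \<in> cube m" "m \<ge> 1" "cols a b = t'" using ex_cols by blast
    have "t \<sqsubseteq> cols a b" using assms ab by simp
    from sig_transport[OF assms(1) xy this ab(1-3)]
    obtain g where "(m, g) \<in> F" "g a = x" "g b = y" .
    with sigI[of m g F a b] ab show ?thesis by simp
  next
    case False
    hence "t = t'" using assms(2) by (auto simp: rel_le_iff rel_eq_iff)
    thus ?thesis using xy by simp
  qed
qed

text \<open>One member attains both \<open>x\<close> and \<open>y\<close>, and its value at
  \<open>c\<close> is the intermediate point of the composition.\<close>

lemma sig_path:
  assumes "minor_closed F" "a \<in> cube m" "b \<in> cube m" "c \<in> cube m" "m \<ge> 1"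
  shows "sig F (cols a b) \<sqsubseteq> sig F (cols a c) \<odot> sig F (cols c b)"
  unfolding rel_le_iff mem_rel_comp
proof (intro allI impI)
  fix x y assume "mem (sig F (cols a b)) x y"
  from sig_transport[OF assms(1) this rel_le_refl assms(2,3,5)]
  obtain g where "(m, g) \<in> F" "g a = x" "g b = y" .
  with sigI[of m g F a c] sigI[of m g F c b] assms(2-4)
  have "mem (sig F (cols a c)) x (g c) \<and> mem (sig F (cols c b)) (g c) y" by simp
  thus "\<exists>z. mem (sig F (cols a c)) x z \<and> mem (sig F (cols c b)) z y" ..
qed

text \<open>A member attaining a value at \<open>a\<close> also has some value at \<open>b\<close>.
  Hence the types of equal tuples carry no further information and can be omitted from
  \<open>data\<close>.\<close>

lemma sig_diag:
  assumes F: "minor_closed F" and ab: "a \<in> cube m" "b \<in> cube m" "m \<ge> 1"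
  shows "sig F (cols a a) = diag_dom (sig F (cols a b))"
  unfolding rel_eq_iff mem_diag_dom
proof (intro allI iffI; (elim conjE exE)?)
  fix x y assume "mem (sig F (cols a a)) x y"
  from sig_transport[OF F this rel_le_refl ab(1,1,3)] obtain g where "(m, g) \<in> F" "g a = x" "g a = y" .
  thus "x = y \<and> (\<exists>z. mem (sig F (cols a b)) x z)" using sigI[of m g F a b] ab by auto
next
  fix x y z assume "x = y" "mem (sig F (cols a b)) x z"
  from sig_transport[OF F this(2) rel_le_refl ab] obtain g where "(m, g) \<in> F" "g a = x" "g b = z" .
  thus "mem (sig F (cols a a)) x y" using sigI[of m g F a a] ab \<open>x = y\<close> by simp
qed

lemma sig_conv: "rel_conv (sig F t) = sig F (rel_conv t)"
proof -
  have inv: "rel_conv (rel_conv t) = t" by (cases t) simp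
  have "mem (sig F (rel_conv t)) x y" if "mem (sig F t) y x" for t x y
    using that by (fastforce simp: sig_def cube_def conv_cols)
  from this[of t] this[of "rel_conv t"] show ?thesis
    by (subst rel_eq_iff) (auto simp: inv)
qed

lemma sig_diagonals:
  assumes "minor_closed F"
  shows "sig F (Rel True False False False) = diag_dom (sig F (Rel False True False False))"
    and "sig F (Rel False False False True) = diag_dom (rel_conv (sig F (Rel False True False False)))"
    and "sig F (Rel True False False True) = diag_dom (sig F (Rel False True True False))"
  using sig_diag[OF assms, of "[False]" 1 "[True]"] sig_diag[OF assms, of "[True]" 1 "[False]"]
    sig_diag[OF assms, of "[True, False]" 2 "[False, True]"] sig_conv[of F "Rel False True False False"]
  by (simp_all add: cols_def rel_of_def cube_def)

section \<open>Interpolation by the majority function\<close>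

definition maj :: boolfun where
  "maj = (3, \<lambda>a \<in> cube 3. a ! 0 \<and> a ! 1 \<or> a ! 0 \<and> a ! 2 \<or> a ! 1 \<and> a ! 2)"

lemma maj_in_SM: "maj \<in> \<S>\<M>"
  by (auto simp: maj_def Selfdual_Monotone_def Selfdual_def Monotone_def Omega_def cube_def
      tuple_compl_def tuple_le_def numeral_3_eq_3 numeral_2_eq_2 length_Suc_conv)

text \<open>The argument of Baker and Pixley: a function that is interpolated on three subsets of a finite
  set, each missing one point, is interpolated on the whole set by the majority.\<close>

lemma stable_eq_sig:
  assumes F: "J_SM_stable F" and f: "(m, f) \<in> \<Omega>"
    and loc: "\<And>a b. a \<in> cube m \<Longrightarrow> b \<in> cube m \<Longrightarrow> mem (sig F (cols a b)) (f a) (f b)"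
  shows "(m, f) \<in> F"
proof -
  have m: "m \<ge> 1" using f by (auto simp: Omega_def)
  have mc: "minor_closed F" and lc: "left_closed \<S>\<M> F" and sub: "F \<subseteq> \<Omega>"
    using F by (auto simp: J_SM_stable_def)
  have two: "\<exists>g. (m, g) \<in> F \<and> g a = f a \<and> g b = f b" if "a \<in> cube m" "b \<in> cube m" for a b
    by (rule sig_transport[OF mc loc[OF that] rel_le_refl that m]) blast
  have "\<exists>g. (m, g) \<in> F \<and> (\<forall>a\<in>X. g a = f a)" if "finite X" "X \<subseteq> cube m" for X
    using that
  proof (induction "card X" arbitrary: X rule: less_induct)
    case less
    have z: "zeros m \<in> cube m" by (simp add: cube_def)
    show ?case
    \<comment> \<open>Tuples outside \<open>X\<close> are allowed here, so \<open>z\<close> settles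
      the empty set, and the other case provides three distinct points.\<close>
    proof (cases "\<exists>a\<in>cube m. \<exists>b\<in>cube m. X \<subseteq> {a, b}")
      case True
      then show ?thesis using two by blast
    next
      case False
      then obtain p where p: "p \<in> X" using z by blast
      then obtain q where q: "q \<in> X" "q \<noteq> p" using False less.prems by blast
      then obtain r where r: "r \<in> X" "r \<noteq> p" "r \<noteq> q" using False less.prems p by blast
      have "\<exists>g. (m, g) \<in> F \<and> (\<forall>a\<in>X - {d}. g a = f a)" if "d \<in> X" for d
        using that less.prems card_Diff1_less[of X d] by (intro less.hyps) auto
      then obtain g where g: "\<And>d. d \<in> X \<Longrightarrow> (m, g d) \<in> F \<and> (\<forall>a\<in>X - {d}. g d a = f a)" by metis
      \<comment> \<open>Each of the three interpolants can fail only at its omitted point, so at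
        every point of \<open>X\<close> at least two of them are right.\<close>
      define h where "h i = g (if i = 0 then p else if i = 1 then q else r)" for i :: nat
      have "compose maj m h \<in> F"
        using lc maj_in_SM g p q r by (auto simp: left_closed_def maj_def h_def)
      moreover have "snd (compose maj m h) a = f a" if "a \<in> X" for a
      proof -
        have "[0..<3] = [0, 1, 2 :: nat]" by (simp add: upt_rec)
        hence "snd (compose maj m h) a \<longleftrightarrow> h 0 a \<and> h 1 a \<or> h 0 a \<and> h 2 a \<or> h 1 a \<and> h 2 a"
          using that less.prems by (auto simp: compose_def maj_def cube_def)
        moreover have "g d a = f a" if "d \<in> {p, q, r}" "d \<noteq> a" for d
          using that g[of d] p q r \<open>a \<in> X\<close> by auto
        ultimately show ?thesis using q(2) r(2,3) by (auto simp: h_def)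
      qed
      ultimately show ?thesis by (intro exI[of _ "snd (compose maj m h)"]) (auto simp: compose_def maj_def)
    qed
  qed
  moreover have "finite (cube m)"
    using finite_lists_length_eq[of "UNIV :: bool set" m] by (simp add: cube_def)
  ultimately obtain g where g: "(m, g) \<in> F" "\<forall>a\<in>cube m. g a = f a" by blast
  hence "g = f"
    using f sub by (auto simp: Omega_def intro!: PiE_ext[of g "cube m" "\<lambda>_. UNIV" f])
  thus ?thesis using g by simp
qed


section \<open>At most 93 stable classes\<close>

text \<open>The types of pairs of tuples, up to exchanging the two tuples and without the types of pairs
  of equal tuples: pairs with columns 01; 00, 01; 01, 11; 01, 10; 00, 01, 10; 01, 10, 11;
  00, 01, 11; and all four.\<close>

definition data :: "boolfun set \<Rightarrow> brel \<times> brel \<times> brel \<times> brel \<times> brel \<times> brel \<times> brel \<times> brel" where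
  "data F =
    (sig F (Rel False True False False), sig F (Rel True True False False),
     sig F (Rel False True False True), sig F (Rel False True True False),
     sig F (Rel True True True False), sig F (Rel False True True True),
     sig F (Rel True True False True), sig F (Rel True True True True))"

text \<open>Of the 16 column sets, eight are stored, four are converses of stored ones, three come
  from equal tuples, and the empty one never occurs in positive arity. So the two signatures agree
  everywhere, and interpolation in \<open>F'\<close> recovers every member of
  \<open>F\<close>.\<close>

lemma data_subset:
  assumes F: "J_SM_stable F" "J_SM_stable F'" and eq: "data F = data F'"
  shows "F \<subseteq> F'"
proof (rule subrelI)
  fix m f assume f: "(m, f) \<in> F"
  have mc: "minor_closed F" "minor_closed F'" and f': "(m, f) \<in> \<Omega>"
    using F f by (auto simp: J_SM_stable_def)
  have d: "sig F (Rel False True False False) = sig F' (Rel False True False False)"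
    "sig F (Rel True True False False) = sig F' (Rel True True False False)"
    "sig F (Rel False True False True) = sig F' (Rel False True False True)"
    "sig F (Rel False True True False) = sig F' (Rel False True True False)"
    "sig F (Rel True True True False) = sig F' (Rel True True True False)"
    "sig F (Rel False True True True) = sig F' (Rel False True True True)"
    "sig F (Rel True True False True) = sig F' (Rel True True False True)"
    "sig F (Rel True True True True) = sig F' (Rel True True True True)"
    using eq by (simp_all add: data_def)
  have c: "sig F (Rel p r q s) = sig F' (Rel p r q s)" if "sig F (Rel p q r s) = sig F' (Rel p q r s)"
    for p q r s
    using sig_conv[of F "Rel p q r s"] sig_conv[of F' "Rel p q r s"] that by simp
  have e: "mem (sig F (Rel False False False False)) x y = False" for x y
  proof (rule ccontr, simp only: eq_False not_not)
    assume "mem (sig F (Rel False False False False)) x y"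
    then obtain n g a b where g: "(n, g) \<in> F" "a \<in> cube n" "b \<in> cube n"
      and t: "cols a b = Rel False False False False" by (auto simp: sig_def)
    have "n \<ge> 1" using F g by (auto simp: J_SM_stable_def Omega_def)
    with mem_cols[OF g(2,3), of "a ! 0" "b ! 0"] t show False by (auto simp: mem_Rel)
  qed
  have "mem (sig F' t) x y" if "mem (sig F t) x y" for t x y
  proof (cases t)
    case (Rel p q r s)
    show ?thesis
      using that unfolding Rel
      by (cases p; cases q; cases r; cases s)
        (simp_all only: d d[THEN c] sig_diagonals[OF mc(1)] sig_diagonals[OF mc(2)] e False_implies_equals)
  qed
  thus "(m, f) \<in> F'" using f by (intro stable_eq_sig[OF F(2) f']) (blast intro: sigI)
qed

section \<open>Enumeration of the admissible families of relations\<close>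

definition rels :: "brel list" where
  "rels = [Rel p q r s. p \<leftarrow> [False, True], q \<leftarrow> [False, True], r \<leftarrow> [False, True], s \<leftarrow> [False, True]]"

text \<open>By \<open>sig_conv\<close>, the relation at a column set closed under exchange is
  symmetric, which leaves 8 choices instead of 16.\<close>

definition symrels :: "brel list" where
  "symrels = [Rel p q q s. p \<leftarrow> [False, True], q \<leftarrow> [False, True], s \<leftarrow> [False, True]]"

text \<open>The conditions on each component are a choice of instances of monotonicity and path consistency
  that cuts out exactly the families of the stable classes.\<close>

definition candidates :: "(brel \<times> brel \<times> brel \<times> brel \<times> brel \<times> brel \<times> brel \<times> brel) list" where
  "candidates =
    [(Q, A, B, E, G, H, D, Z).
       Q \<leftarrow> rels,
       A \<leftarrow> rels, Q \<sqsubseteq> A, diag_dom Q \<sqsubseteq> A, A \<sqsubseteq> diag_dom Q \<odot> A,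
       B \<leftarrow> rels, Q \<sqsubseteq> B, diag_dom (rel_conv Q) \<sqsubseteq> B, B \<sqsubseteq> rel_conv A \<odot> Q, A \<sqsubseteq> Q \<odot> rel_conv B,
       E \<leftarrow> symrels, Q \<sqsubseteq> E, E \<sqsubseteq> B \<odot> rel_conv B, B \<sqsubseteq> E \<odot> B,
       G \<leftarrow> symrels, A \<sqsubseteq> G, E \<sqsubseteq> G, G \<sqsubseteq> rel_conv A \<odot> A,
       H \<leftarrow> symrels, B \<sqsubseteq> H, E \<sqsubseteq> H, H \<sqsubseteq> rel_conv A \<odot> A,
       D \<leftarrow> rels, A \<sqsubseteq> D, B \<sqsubseteq> D, diag_dom E \<sqsubseteq> D, D \<sqsubseteq> E \<odot> H, D \<sqsubseteq> G \<odot> E, G \<sqsubseteq> D \<odot> E, H \<sqsubseteq> E \<odot> D,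
       Z \<leftarrow> symrels, D \<sqsubseteq> Z, Z \<sqsubseteq> rel_conv A \<odot> A]"

text \<open>Each test comes as soon as its components are chosen, so the search is pruned
  early.\<close>

lemma length_candidates: "length candidates = 93"
  by code_simp

lemma mem_rels: "t \<in> set rels"
proof (cases t)
  case (Rel p q r s)
  show ?thesis unfolding Rel by (cases p; cases q; cases r; cases s) (simp_all add: rels_def)
qed

lemma mem_symrels:
  assumes "rel_conv t = t"
  shows "t \<in> set symrels"
proof (cases t)
  case (Rel p q r s)
  show ?thesis
    using assms unfolding Rel by (cases p; cases q; cases r; cases s) (simp_all add: symrels_def)
qed

lemma data_in_candidates:
  assumes "J_SM_stable F"
  shows "data F \<in> set candidates"
proof -
  have F: "minor_closed F" using assms by (simp add: J_SM_stable_def)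
  define Q where "Q = sig F (Rel False True False False)"
  define A where "A = sig F (Rel True True False False)"
  define B where "B = sig F (Rel False True False True)"
  define E where "E = sig F (Rel False True True False)"
  define G where "G = sig F (Rel True True True False)"
  define H where "H = sig F (Rel False True True True)"
  define D where "D = sig F (Rel True True False True)"
  define Z where "Z = sig F (Rel True True True True)"
  note defs = Q_def A_def B_def E_def G_def H_def D_def Z_def
  \<comment> \<open>The tests with a composition come from small explicit tuples. The middle tuple
    \<open>c\<close> is always constant or the complement of \<open>a\<close> or
    \<open>b\<close>.\<close>
  have path: "sig F t \<sqsubseteq> sig F t' \<odot> sig F t''"
    if "cols a b = t" "cols a c = t'" "cols c b = t''" "length b = length a" "length c = length a" "a \<noteq> []"
    for a b c t t' t''
    using sig_path[OF F, of a "length a" b c] that by (cases a) (simp_all add: cube_def)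
  have "E \<in> set symrels" "G \<in> set symrels" "H \<in> set symrels" "Z \<in> set symrels"
    by (simp_all add: defs mem_symrels sig_conv)
  moreover have "Q \<sqsubseteq> A" "Q \<sqsubseteq> B" "Q \<sqsubseteq> E" "A \<sqsubseteq> G" "E \<sqsubseteq> G" "B \<sqsubseteq> H" "E \<sqsubseteq> H" "A \<sqsubseteq> D" "B \<sqsubseteq> D" "D \<sqsubseteq> Z"
    unfolding defs by (rule sig_mono[OF F], simp)+
  \<comment> \<open>The left sides are the relations at 00; 11; 00, 11, so this is again
    monotonicity.\<close>
  moreover have "diag_dom Q \<sqsubseteq> A" "diag_dom (rel_conv Q) \<sqsubseteq> B" "diag_dom E \<sqsubseteq> D"
    unfolding defs sig_diagonals[OF F, symmetric] by (rule sig_mono[OF F], simp)+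
  moreover have "A \<sqsubseteq> diag_dom Q \<odot> A"
    unfolding defs sig_conv sig_diagonals[OF F, symmetric]
    by (rule path[of "[False, False]" "[False, True]" _ "[False, False]"])
      (simp_all add: cols_def rel_of_def)
  moreover have "B \<sqsubseteq> rel_conv A \<odot> Q"
    unfolding defs sig_conv sig_diagonals[OF F, symmetric]
    by (rule path[of "[False, True]" "[True, True]" _ "[False, False]"])
      (simp_all add: cols_def rel_of_def)
  moreover have "A \<sqsubseteq> Q \<odot> rel_conv B"
    unfolding defs sig_conv sig_diagonals[OF F, symmetric]
    by (rule path[of "[False, False]" "[False, True]" _ "[True, True]"])
      (simp_all add: cols_def rel_of_def)
  moreover have "E \<sqsubseteq> B \<odot> rel_conv B"
    unfolding defs sig_conv sig_diagonals[OF F, symmetric]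
    by (rule path[of "[False, True]" "[True, False]" _ "[True, True]"])
      (simp_all add: cols_def rel_of_def)
  moreover have "B \<sqsubseteq> E \<odot> B"
    unfolding defs sig_conv sig_diagonals[OF F, symmetric]
    by (rule path[of "[False, True]" "[True, True]" _ "[True, False]"])
      (simp_all add: cols_def rel_of_def)
  moreover have "G \<sqsubseteq> rel_conv A \<odot> A"
    unfolding defs sig_conv sig_diagonals[OF F, symmetric]
    by (rule path[of "[False, False, True]" "[False, True, False]" _ "[False, False, False]"])
      (simp_all add: cols_def rel_of_def)
  moreover have "H \<sqsubseteq> rel_conv A \<odot> A"
    unfolding defs sig_conv sig_diagonals[OF F, symmetric]
    by (rule path[of "[False, True, True]" "[True, False, True]" _ "[False, False, False]"])
      (simp_all add: cols_def rel_of_def)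
  moreover have "D \<sqsubseteq> E \<odot> H"
    unfolding defs sig_conv sig_diagonals[OF F, symmetric]
    by (rule path[of "[False, False, True]" "[False, True, True]" _ "[True, True, False]"])
      (simp_all add: cols_def rel_of_def)
  moreover have "D \<sqsubseteq> G \<odot> E"
    unfolding defs sig_conv sig_diagonals[OF F, symmetric]
    by (rule path[of "[False, False, True]" "[False, True, True]" _ "[True, False, False]"])
      (simp_all add: cols_def rel_of_def)
  moreover have "G \<sqsubseteq> D \<odot> E"
    unfolding defs sig_conv sig_diagonals[OF F, symmetric]
    by (rule path[of "[False, False, True]" "[False, True, False]" _ "[True, False, True]"])
      (simp_all add: cols_def rel_of_def)
  moreover have "H \<sqsubseteq> E \<odot> D"
    unfolding defs sig_conv sig_diagonals[OF F, symmetric]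
    by (rule path[of "[False, True, True]" "[True, False, True]" _ "[True, False, False]"])
      (simp_all add: cols_def rel_of_def)
  moreover have "Z \<sqsubseteq> rel_conv A \<odot> A"
    unfolding defs sig_conv sig_diagonals[OF F, symmetric]
    by (rule path[of "[False, False, True, True]" "[False, True, False, True]" _ "[False, False, False, False]"])
      (simp_all add: cols_def rel_of_def)
  ultimately have "(Q, A, B, E, G, H, D, Z) \<in> set candidates"
    by (simp add: candidates_def mem_rels)
  thus ?thesis by (simp add: data_def defs)
qed

text \<open>\<open>data\<close> is injective on stable classes, since \<open>data_subset\<close>
  applies in both directions.\<close>

lemma card_stable_le: "finite {F. J_SM_stable F}" "card {F. J_SM_stable F} \<le> 93"
proof -
  have inj: "inj_on data {F. J_SM_stable F}"
    by (intro inj_onI equalityI data_subset) auto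
  have sub: "data ` {F. J_SM_stable F} \<subseteq> set candidates"
    using data_in_candidates by auto
  show "finite {F. J_SM_stable F}"
    using finite_subset[OF sub] inj by (simp add: finite_image_iff)
  show "card {F. J_SM_stable F} \<le> 93"
    using card_inj_on_le[OF inj sub] card_length[of candidates] length_candidates by simp
qed

section \<open>The listed classes as constrained classes\<close>

text \<open>The names from here on say which pairs of tuples a column bound admits, as
  \<open>cols_le_iff\<close> shows: columns among 00, 01, 10, for example, mean disjoint
  tuples.\<close>

definition on_zeros :: "(bool \<Rightarrow> bool \<Rightarrow> bool) \<Rightarrow> brel \<times> brel" where
  "on_zeros p = (Rel True False False False, rel_of p)"

definition on_ones :: "(bool \<Rightarrow> bool \<Rightarrow> bool) \<Rightarrow> brel \<times> brel" where
  "on_ones p = (Rel False False False True, rel_of p)"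

definition on_ends :: "(bool \<Rightarrow> bool \<Rightarrow> bool) \<Rightarrow> brel \<times> brel" where
  "on_ends p = (Rel False True False False, rel_of p)"

definition from_zeros :: "(bool \<Rightarrow> bool \<Rightarrow> bool) \<Rightarrow> brel \<times> brel" where
  "from_zeros p = (Rel True True False False, rel_of p)"

definition to_ones :: "(bool \<Rightarrow> bool \<Rightarrow> bool) \<Rightarrow> brel \<times> brel" where
  "to_ones p = (Rel False True False True, rel_of p)"

definition on_le :: "(bool \<Rightarrow> bool \<Rightarrow> bool) \<Rightarrow> brel \<times> brel" where
  "on_le p = (Rel True True False True, rel_of p)"

definition on_compl :: "(bool \<Rightarrow> bool \<Rightarrow> bool) \<Rightarrow> brel \<times> brel" where
  "on_compl p = (Rel False True True False, rel_of p)"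

definition on_disjoint :: "(bool \<Rightarrow> bool \<Rightarrow> bool) \<Rightarrow> brel \<times> brel" where
  "on_disjoint p = (Rel True True True False, rel_of p)"

definition on_covering :: "(bool \<Rightarrow> bool \<Rightarrow> bool) \<Rightarrow> brel \<times> brel" where
  "on_covering p = (Rel False True True True, rel_of p)"

definition on_all :: "(bool \<Rightarrow> bool \<Rightarrow> bool) \<Rightarrow> brel \<times> brel" where
  "on_all p = (Rel True True True True, rel_of p)"

lemmas constraint_defs = on_zeros_def on_ones_def on_ends_def from_zeros_def to_ones_def on_le_def
  on_compl_def on_disjoint_def on_covering_def on_all_def

abbreviation (input) nand :: "bool \<Rightarrow> bool \<Rightarrow> bool" where
  "nand x y \<equiv> \<not> (x \<and> y)"

abbreviation (input) revimp :: "bool \<Rightarrow> bool \<Rightarrow> bool" where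
  "revimp x y \<equiv> y \<longrightarrow> x"

abbreviation "at_zeros v \<equiv> on_zeros (\<lambda>x y. x = v)"
abbreviation "at_ones v \<equiv> on_ones (\<lambda>x y. x = v)"

text \<open>A union with the constants as one binary constraint: unless the value at the end tuple
  is \<open>v\<close>, every value has to equal it.\<close>

abbreviation "at_zeros_or_const v \<equiv> from_zeros (\<lambda>x y. x = v \<or> x = y)"
abbreviation "at_ones_or_const v \<equiv> to_ones (\<lambda>x y. y = v \<or> x = y)"

section \<open>Membership in constrained classes\<close>

lemma constrained_Nil: "constrained [] = \<Omega>"
  by (auto simp: constrained_def)

lemma constrained_append: "constrained (cs @ ds) = constrained cs \<inter> constrained ds"
  by (auto simp: constrained_def ball_Un)

lemma constrained_pair: "constrained [c, d] = constrained [c] \<inter> constrained [d]"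
  using constrained_append[of "[c]" "[d]"] by simp

lemma constrained_subset: "constrained cs \<subseteq> \<Omega>"
  by (auto simp: constrained_def)

lemma zeros_in_cube [simp]: "zeros n \<in> cube n" and ones_in_cube [simp]: "ones n \<in> cube n"
  and compl_in_cube [simp]: "tuple_compl a \<in> cube n \<longleftrightarrow> a \<in> cube n"
  by (auto simp: cube_def tuple_compl_def)

lemma cube_nonempty [simp]: "cube n \<noteq> {}"
  using zeros_in_cube by blast

lemma cols_le_iff:
  assumes "a \<in> cube n" "b \<in> cube n"
  shows "cols a b \<sqsubseteq> Rel True False False False \<longleftrightarrow> a = zeros n \<and> b = zeros n"
    and "cols a b \<sqsubseteq> Rel False False False True \<longleftrightarrow> a = ones n \<and> b = ones n"
    and "cols a b \<sqsubseteq> Rel False True False False \<longleftrightarrow> a = zeros n \<and> b = ones n"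
    and "cols a b \<sqsubseteq> Rel True True False False \<longleftrightarrow> a = zeros n"
    and "cols a b \<sqsubseteq> Rel False True False True \<longleftrightarrow> b = ones n"
    and "cols a b \<sqsubseteq> Rel True True False True \<longleftrightarrow> tuple_le a b"
    and "cols a b \<sqsubseteq> Rel False True True False \<longleftrightarrow> b = tuple_compl a"
    and "cols a b \<sqsubseteq> Rel True True True False \<longleftrightarrow> tuple_meet a b = zeros n"
    and "cols a b \<sqsubseteq> Rel False True True True \<longleftrightarrow> tuple_join a b = ones n"
    and "cols a b \<sqsubseteq> Rel True True True True"
  using assms unfolding cols_le[OF assms]
  by (auto simp: mem_Rel cube_def tuple_le_def tuple_compl_def tuple_meet_def tuple_join_def
      list_eq_iff_nth_eq list_all2_conv_all_nth)

lemma constrained_single: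
  "(n, f) \<in> constrained [on_zeros p] \<longleftrightarrow> (n, f) \<in> \<Omega> \<and> p (f (zeros n)) (f (zeros n))"
  "(n, f) \<in> constrained [on_ones p] \<longleftrightarrow> (n, f) \<in> \<Omega> \<and> p (f (ones n)) (f (ones n))"
  "(n, f) \<in> constrained [on_ends p] \<longleftrightarrow> (n, f) \<in> \<Omega> \<and> p (f (zeros n)) (f (ones n))"
  "(n, f) \<in> constrained [from_zeros p] \<longleftrightarrow> (n, f) \<in> \<Omega> \<and> (\<forall>b\<in>cube n. p (f (zeros n)) (f b))"
  "(n, f) \<in> constrained [to_ones p] \<longleftrightarrow> (n, f) \<in> \<Omega> \<and> (\<forall>a\<in>cube n. p (f a) (f (ones n)))"
  "(n, f) \<in> constrained [on_le p] \<longleftrightarrow>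
     (n, f) \<in> \<Omega> \<and> (\<forall>a\<in>cube n. \<forall>b\<in>cube n. tuple_le a b \<longrightarrow> p (f a) (f b))"
  "(n, f) \<in> constrained [on_compl p] \<longleftrightarrow> (n, f) \<in> \<Omega> \<and> (\<forall>a\<in>cube n. p (f a) (f (tuple_compl a)))"
  "(n, f) \<in> constrained [on_disjoint p] \<longleftrightarrow>
     (n, f) \<in> \<Omega> \<and> (\<forall>a\<in>cube n. \<forall>b\<in>cube n. tuple_meet a b = zeros n \<longrightarrow> p (f a) (f b))"
  "(n, f) \<in> constrained [on_covering p] \<longleftrightarrow>
     (n, f) \<in> \<Omega> \<and> (\<forall>a\<in>cube n. \<forall>b\<in>cube n. tuple_join a b = ones n \<longrightarrow> p (f a) (f b))"
  "(n, f) \<in> constrained [on_all p] \<longleftrightarrow> (n, f) \<in> \<Omega> \<and> (\<forall>a\<in>cube n. \<forall>b\<in>cube n. p (f a) (f b))"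
  by (auto simp: constrained_def constraint_defs cols_le_iff)

lemma val_zeros_constrained: "val_zeros (constrained cs) v = constrained (cs @ [at_zeros v])"
  using constrained_subset[of cs]
  by (auto simp: val_zeros_def constrained_append constrained_single)

lemma val_ones_constrained: "val_ones (constrained cs) v = constrained (cs @ [at_ones v])"
  using constrained_subset[of cs]
  by (auto simp: val_ones_def constrained_append constrained_single)

lemma val_both_constrained: "val_both (constrained cs) v w = constrained (cs @ [at_zeros v, at_ones w])"
  unfolding val_both_def val_zeros_constrained val_ones_constrained
  using constrained_append[of "cs @ [at_zeros v]" "[at_ones w]"]
  by (auto simp: constrained_append)

lemma sub_constrained:
  "sub_eq (constrained cs) = constrained (cs @ [on_ends (=)])"
  "sub_neq (constrained cs) = constrained (cs @ [on_ends (\<noteq>)])"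
  "sub_le (constrained cs) = constrained (cs @ [on_ends (\<longrightarrow>)])"
  "sub_ge (constrained cs) = constrained (cs @ [on_ends revimp])"
  "sub_neq_00 (constrained cs) = constrained (cs @ [on_ends nand])"
  "sub_neq_11 (constrained cs) = constrained (cs @ [on_ends (\<or>)])"
  using constrained_subset[of cs]
  by (auto simp: sub_eq_def sub_neq_def sub_le_def sub_ge_def sub_neq_00_def sub_neq_11_def
      val_both_def val_zeros_def val_ones_def constrained_append constrained_single)

lemma boolfun_set_eqI:
  fixes A B :: "boolfun set"
  shows "(\<And>n f. (n, f) \<in> A \<longleftrightarrow> (n, f) \<in> B) \<Longrightarrow> A = B"
  by auto

lemma empty_constrained: "{} = constrained [on_all (\<lambda>x y. False)]"
  using zeros_in_cube by (auto simp: constrained_single)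

lemma Const_val_constrained: "Const_val v = constrained [on_all (\<lambda>x y. x = v)]"
  using zeros_in_cube by (auto simp: Const_val_def constrained_single)

lemma Const_constrained: "\<C> = constrained [on_all (=)]"
proof -
  have *: "(\<exists>c. \<forall>a\<in>cube n. f a = c) \<longleftrightarrow> (\<forall>a\<in>cube n. \<forall>b\<in>cube n. f a = f b)"
    for n and f :: "bool list \<Rightarrow> bool"
  proof
    assume "\<forall>a\<in>cube n. \<forall>b\<in>cube n. f a = f b"
    hence "\<forall>a\<in>cube n. f a = f (zeros n)" using zeros_in_cube by blast
    thus "\<exists>c. \<forall>a\<in>cube n. f a = c" ..
  qed auto
  show ?thesis
    by (rule boolfun_set_eqI) (simp only: Const_def constrained_single mem_Collect_eq case_prod_conv *)
qed

lemma Monotone_constrained: "\<M> = constrained [on_le (\<longrightarrow>)]"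
  by (auto simp: Monotone_def constrained_single)

lemma Selfdual_constrained: "\<S> = constrained [on_compl (\<noteq>)]"
proof (rule boolfun_set_eqI)
  have *: "(y = (\<not> x)) = (x \<noteq> y)" for x y by auto
  show "(n, f) \<in> \<S> \<longleftrightarrow> (n, f) \<in> constrained [on_compl (\<noteq>)]" for n f
    by (simp only: Selfdual_def constrained_single mem_Collect_eq case_prod_conv *)
qed

lemma Reflexive_constrained: "\<R> = constrained [on_compl (=)]"
  by (rule boolfun_set_eqI) (simp only: Reflexive_def constrained_single mem_Collect_eq case_prod_conv)

lemma U2_constrained: "\<U>\<^sup>2 = constrained [on_disjoint nand]"
  by (rule boolfun_set_eqI) (simp only: U2_def constrained_single mem_Collect_eq case_prod_conv, blast)

lemma W2_constrained: "\<W>\<^sup>2 = constrained [on_covering (\<or>)]"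
  by (rule boolfun_set_eqI) (simp only: W2_def constrained_single mem_Collect_eq case_prod_conv, blast)

lemma Sminus_constrained: "\<S>\<^sup>- = constrained [on_compl nand]"
proof (intro equalityI subrelI)
  fix n f assume "(n, f) \<in> \<S>\<^sup>-"
  thus "(n, f) \<in> constrained [on_compl nand]"
    by (auto simp: Sminus_def Selfdual_def constrained_single)
next
  fix n f assume f: "(n, f) \<in> constrained [on_compl nand]"
  \<comment> \<open>The self-dual function above \<open>f\<close> keeps its values on complementary
    pairs where \<open>f\<close> takes both values. Where \<open>f\<close> is 0 at both, the first
    coordinate decides, which differs between complements.\<close>
  define g where "g = (\<lambda>a\<in>cube n. f a \<or> \<not> f (tuple_compl a) \<and> a ! 0)"
  have "(n, g) \<in> \<S>"
    using f by (auto simp: constrained_single Selfdual_def Omega_def g_def tuple_compl_def cube_def Suc_le_eq comp_def)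
  thus "(n, f) \<in> \<S>\<^sup>-"
    using f by (auto simp: Sminus_def constrained_single g_def intro!: exI[of _ g])
qed

lemma Splus_constrained: "\<S>\<^sup>+ = constrained [on_compl (\<or>)]"
proof (intro equalityI subrelI)
  fix n f assume "(n, f) \<in> \<S>\<^sup>+"
  thus "(n, f) \<in> constrained [on_compl (\<or>)]"
    by (auto simp: Splus_def Selfdual_def constrained_single)
next
  fix n f assume f: "(n, f) \<in> constrained [on_compl (\<or>)]"
  \<comment> \<open>Dually, the first coordinate decides on complementary pairs where
    \<open>f\<close> is 1 at both.\<close>
  define g where "g = (\<lambda>a\<in>cube n. f a \<and> (\<not> f (tuple_compl a) \<or> a ! 0))"
  have "(n, g) \<in> \<S>"
    using f by (auto simp: constrained_single Selfdual_def Omega_def g_def tuple_compl_def cube_def Suc_le_eq comp_def)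
  thus "(n, f) \<in> \<S>\<^sup>+"
    using f by (auto simp: Splus_def constrained_single g_def intro!: exI[of _ g])
qed

section \<open>Negated classes\<close>

lemma negation_negation: "p \<in> \<Omega> \<Longrightarrow> negation (negation p) = p"
  by (cases p) (auto simp: negation_def Omega_def PiE_def extensional_def fun_eq_iff)

lemma negation_constrained:
  assumes "p \<in> constrained cs"
  shows "negation p \<in> constrained (map (map_prod id neg_rel) cs)"
  using assms by (cases p) (fastforce simp: constrained_def negation_def Omega_def mem_neg_rel)

text \<open>Negation changes the entries of the value relations and leaves the column bounds alone.
  Since it is an involution, one inclusion yields the other.\<close>

lemma neg_constrained: "neg (constrained cs) = constrained (map (map_prod id neg_rel) cs)"
proof (intro equalityI subsetI)
  fix p assume "p \<in> neg (constrained cs)"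
  thus "p \<in> constrained (map (map_prod id neg_rel) cs)"
    using negation_constrained by (auto simp: neg_def)
next
  fix p assume p: "p \<in> constrained (map (map_prod id neg_rel) cs)"
  have "neg_rel (neg_rel r) = r" for r by (cases r) simp
  hence "map (map_prod id neg_rel) (map (map_prod id neg_rel) cs) = cs" by (induction cs) auto
  with negation_constrained[OF p] have "negation p \<in> constrained cs" by metis
  moreover have "p = negation (negation p)"
    using p constrained_subset by (metis negation_negation subsetD)
  ultimately show "p \<in> neg (constrained cs)" by (auto simp: neg_def)
qed

lemma neg_class_constrained:
  "neg \<M> = constrained [on_le revimp]"
  "neg \<U>\<^sup>2 = constrained [on_disjoint (\<or>)]"
  "neg \<W>\<^sup>2 = constrained [on_covering nand]"
  "neg \<S>\<M> = constrained [on_compl (\<noteq>), on_le revimp]"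
  "neg \<M>\<U>\<^sup>2 = constrained [on_le revimp, on_disjoint (\<or>)]"
  "neg \<M>\<W>\<^sup>2 = constrained [on_le revimp, on_covering nand]"
  unfolding Monotone_constrained U2_constrained W2_constrained Selfdual_Monotone_def
    Selfdual_constrained MU2_def MW2_def constrained_append[symmetric] neg_constrained
  by (simp_all add: constraint_defs rel_of_def)

section \<open>Unions with constant functions\<close>

definition allows :: "bool \<Rightarrow> (brel \<times> brel) list \<Rightarrow> bool" where
  "allows c cs \<longleftrightarrow> list_all (\<lambda>(T, R). mem R c c) cs"

lemma allows_simps:
  "allows c []"
  "allows c (on_compl p # cs) \<longleftrightarrow> p c c \<and> allows c cs"
  "allows c (on_disjoint p # cs) \<longleftrightarrow> p c c \<and> allows c cs"
  "allows c (on_covering p # cs) \<longleftrightarrow> p c c \<and> allows c cs"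
  by (simp_all add: allows_def constraint_defs)

text \<open>A constant function shows only the pair \<open>(c, c)\<close> of values, which is all
  that \<open>allows\<close> tests.\<close>

lemma Const_val_subset: "allows c cs \<Longrightarrow> Const_val c \<subseteq> constrained cs"
  by (fastforce simp: allows_def list_all_iff Const_val_def constrained_def)

lemma Const_eq: "\<C> = \<C>\<^sub>0 \<union> \<C>\<^sub>1"
  unfolding Const_def Const_val_def by (auto; metis (full_types))

lemma Const_subset: "allows False cs \<Longrightarrow> allows True cs \<Longrightarrow> \<C> \<subseteq> constrained cs"
  using Const_val_subset Const_eq by blast

lemma Const_iff:
  assumes "c \<in> cube n"
  shows "(n, f) \<in> \<C> \<longleftrightarrow> (n, f) \<in> \<Omega> \<and> (\<forall>a\<in>cube n. f c = f a)"
  unfolding Const_constrained constrained_single using assms by metis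

lemma val_Un_Const:
  "val_zeros \<Omega> v \<union> \<C> = constrained [at_zeros_or_const v]"
  "val_ones \<Omega> v \<union> \<C> = constrained [at_ones_or_const v]"
proof (rule_tac [!] boolfun_set_eqI)
  fix n and f :: "bool list \<Rightarrow> bool"
  have comm: "(\<forall>a\<in>cube n. c = f a) = (\<forall>a\<in>cube n. f a = c)" for c by metis
  have absorb: "(P \<or> P \<and> Q) = P" for P Q by blast
  show "(n, f) \<in> val_zeros \<Omega> v \<union> \<C> \<longleftrightarrow> (n, f) \<in> constrained [at_zeros_or_const v]"
    by (cases "f (zeros n) = v")
      (simp_all add: val_zeros_def constrained_single Const_iff[of "zeros n"] absorb)
  show "(n, f) \<in> val_ones \<Omega> v \<union> \<C> \<longleftrightarrow> (n, f) \<in> constrained [at_ones_or_const v]"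
    by (cases "f (ones n) = v")
      (simp_all add: val_ones_def constrained_single Const_iff[of "ones n"] absorb comm)
qed

text \<open>Union with \<C> distributes over the intersection of the conditions, and
  \<open>constrained cs\<close> absorbs \<C> because it contains all constants.\<close>

lemma Un_Const_constrained:
  assumes "allows False cs" "allows True cs"
  shows "val_zeros (constrained cs) v \<union> \<C> = constrained (cs @ [at_zeros_or_const v])"
    and "val_ones (constrained cs) v \<union> \<C> = constrained (cs @ [at_ones_or_const v])"
    and "val_both (constrained cs) v w \<union> \<C> = constrained (cs @ [at_zeros_or_const v, at_ones_or_const w])"
proof -
  have z: "val_zeros (constrained cs) v = constrained cs \<inter> val_zeros \<Omega> v"
    and o: "val_ones (constrained cs) w = constrained cs \<inter> val_ones \<Omega> w" for v w
    using constrained_subset[of cs] by (auto simp: val_zeros_def val_ones_def)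
  show "val_zeros (constrained cs) v \<union> \<C> = constrained (cs @ [at_zeros_or_const v])"
    "val_ones (constrained cs) v \<union> \<C> = constrained (cs @ [at_ones_or_const v])"
    "val_both (constrained cs) v w \<union> \<C> = constrained (cs @ [at_zeros_or_const v, at_ones_or_const w])"
    using Const_subset[OF assms]
    unfolding val_both_def z o constrained_append constrained_pair val_Un_Const[symmetric] by blast+
qed

lemma Un_Const_val_constrained:
  "allows v cs \<Longrightarrow>
     val_both (constrained cs) v w \<union> Const_val v = constrained (cs @ [at_zeros v, at_ones_or_const w])"
  "allows w cs \<Longrightarrow>
     val_both (constrained cs) v w \<union> Const_val w = constrained (cs @ [at_zeros_or_const v, at_ones w])"
proof -
  show "val_both (constrained cs) v w \<union> Const_val v = constrained (cs @ [at_zeros v, at_ones_or_const w])"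
    if "allows v cs"
    using Const_val_subset[OF that] constrained_subset[of cs] unfolding constrained_append constrained_pair val_Un_Const[symmetric]
    by (auto simp: val_both_def val_zeros_def val_ones_def Const_def Const_val_def constrained_single)
  show "val_both (constrained cs) v w \<union> Const_val w = constrained (cs @ [at_zeros_or_const v, at_ones w])"
    if "allows w cs"
    using Const_val_subset[OF that] constrained_subset[of cs] unfolding constrained_append constrained_pair val_Un_Const[symmetric]
    by (auto simp: val_both_def val_zeros_def val_ones_def Const_def Const_val_def constrained_single)
qed

text \<open>The order is that of \<open>stable_class_list\<close>, so the two lists can be compared
  entry by entry.\<close>

definition listed_constraints :: "(brel \<times> brel) list list" where
  "listed_constraints =
    [[], [on_ends (\<longrightarrow>)], [on_ends revimp], [on_ends nand], [on_ends (\<or>)],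
     [at_zeros_or_const False], [at_ones_or_const False],
     [at_zeros_or_const False, at_ones_or_const False],
     [at_zeros_or_const False, at_ones_or_const True], [at_zeros False, at_ones_or_const True],
     [at_zeros_or_const False, at_ones True],
     [at_zeros_or_const True], [at_ones_or_const True],
     [at_zeros_or_const True, at_ones_or_const True],
     [at_zeros_or_const True, at_ones_or_const False], [at_zeros True, at_ones_or_const False],
     [at_zeros_or_const True, at_ones False],
     [on_ends (\<noteq>)], [on_ends (=)], [at_zeros False], [at_zeros True], [at_ones False],
     [at_ones True], [at_zeros False, at_ones False], [at_zeros True, at_ones True],
     [at_zeros False, at_ones True], [at_zeros True, at_ones False],
     [on_le (\<longrightarrow>)], [on_le (\<longrightarrow>), at_zeros False],
     [on_le (\<longrightarrow>), at_ones True],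
     [on_le (\<longrightarrow>), at_zeros False, at_ones True], [on_le revimp],
     [on_le revimp, at_zeros True], [on_le revimp, at_ones False],
     [on_le revimp, at_zeros True, at_ones False],
     [on_compl nand], [on_compl nand, on_ends (\<noteq>)], [on_compl nand, at_zeros False],
     [on_compl nand, at_ones False], [on_compl nand, at_zeros False, at_ones_or_const True],
     [on_compl nand, at_zeros_or_const True, at_ones False],
     [on_compl nand, at_zeros False, at_ones True], [on_compl nand, at_zeros True, at_ones False],
     [on_compl nand, at_zeros False, at_ones False],
     [on_compl (\<or>)], [on_compl (\<or>), on_ends (\<noteq>)],
     [on_compl (\<or>), at_zeros True], [on_compl (\<or>), at_ones True],
     [on_compl (\<or>), at_zeros True, at_ones_or_const False],
     [on_compl (\<or>), at_zeros_or_const False, at_ones True],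
     [on_compl (\<or>), at_zeros True, at_ones False],
     [on_compl (\<or>), at_zeros False, at_ones True],
     [on_compl (\<or>), at_zeros True, at_ones True],
     [on_compl (\<noteq>)], [on_compl (\<noteq>), at_zeros False, at_ones True],
     [on_compl (\<noteq>), at_zeros True, at_ones False],
     [on_compl (\<noteq>), on_le (\<longrightarrow>)], [on_compl (\<noteq>), on_le revimp],
     [on_disjoint nand], [on_disjoint nand, at_zeros False, at_ones_or_const True],
     [on_disjoint nand, at_zeros False, at_ones True],
     [on_le (\<longrightarrow>), on_disjoint nand],
     [on_le (\<longrightarrow>), on_disjoint nand, at_zeros False, at_ones True],
     [on_disjoint nand, at_zeros False, at_ones False],
     [on_disjoint (\<or>)], [on_disjoint (\<or>), at_zeros True, at_ones_or_const False],
     [on_disjoint (\<or>), at_zeros True, at_ones False], [on_le revimp, on_disjoint (\<or>)],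
     [on_le revimp, on_disjoint (\<or>), at_zeros True, at_ones False],
     [on_disjoint (\<or>), at_zeros True, at_ones True],
     [on_covering (\<or>)], [on_covering (\<or>), at_zeros_or_const False, at_ones True],
     [on_covering (\<or>), at_zeros False, at_ones True],
     [on_le (\<longrightarrow>), on_covering (\<or>)],
     [on_le (\<longrightarrow>), on_covering (\<or>), at_zeros False, at_ones True],
     [on_covering (\<or>), at_zeros True, at_ones True],
     [on_covering nand], [on_covering nand, at_zeros_or_const True, at_ones False],
     [on_covering nand, at_zeros True, at_ones False], [on_le revimp, on_covering nand],
     [on_le revimp, on_covering nand, at_zeros True, at_ones False],
     [on_covering nand, at_zeros False, at_ones False],
     [on_disjoint nand, on_covering nand], [on_covering (\<or>), on_disjoint (\<or>)],
     [on_compl (=)], [on_compl (=), at_zeros_or_const False, at_ones_or_const False],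
     [on_compl (=), at_zeros_or_const True, at_ones_or_const True],
     [on_compl (=), at_zeros False, at_ones False], [on_compl (=), at_zeros True, at_ones True],
     [on_all (=)], [on_all (\<lambda>x y. x = False)], [on_all (\<lambda>x y. x = True)],
     [on_all (\<lambda>x y. False)]]"

lemma stable_class_list_eq: "stable_class_list = map constrained listed_constraints"
  unfolding stable_class_list_def listed_constraints_def list.map neg_class_constrained
  unfolding Selfdual_Monotone_def MU2_def MW2_def
  \<comment> \<open>Unions with constants are translated as a whole first, while subscripts and
    constants are still unexpanded; the remaining subscripts follow.\<close>
  by (simp only: constrained_Nil[symmetric] Monotone_constrained Selfdual_constrained
      Reflexive_constrained U2_constrained W2_constrained Sminus_constrained Splus_constrained
      constrained_append[symmetric] append.simps Un_Const_constrained Un_Const_val_constrained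
      allows_simps simp_thms,
    simp only: val_zeros_constrained val_ones_constrained val_both_constrained sub_constrained
      append.simps Const_constrained Const_val_constrained empty_constrained simp_thms)

section \<open>The listed classes are pairwise distinct\<close>

definition ternary :: "(bool \<Rightarrow> bool \<Rightarrow> bool \<Rightarrow> bool) \<Rightarrow> boolfun" where
  "ternary w = (3, \<lambda>a \<in> cube 3. w (a ! 0) (a ! 1) (a ! 2))"

text \<open>A finite table over all 64 pairs of ternary tuples, which is everything a binary
  constraint can see of the function.\<close>

definition behaviour :: "(bool \<Rightarrow> bool \<Rightarrow> bool \<Rightarrow> bool) \<Rightarrow> (brel \<times> bool \<times> bool) list" where
  "behaviour w = remdups [(cols [x, y, z] [x', y', z'], w x y z, w x' y' z').
     x \<leftarrow> [False, True], y \<leftarrow> [False, True], z \<leftarrow> [False, True],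
     x' \<leftarrow> [False, True], y' \<leftarrow> [False, True], z' \<leftarrow> [False, True]]"

definition satisfies :: "(brel \<times> bool \<times> bool) list \<Rightarrow> (brel \<times> brel) list \<Rightarrow> bool" where
  "satisfies bs cs \<longleftrightarrow>
     list_all (\<lambda>(T, R). list_all (\<lambda>(t, x, y). t \<sqsubseteq> T \<longrightarrow> mem R x y) bs) cs"

lemma ball_behaviour:
  "(\<forall>p\<in>set (behaviour w). P p) \<longleftrightarrow>
     (\<forall>x y z x' y' z'. P (cols [x, y, z] [x', y', z'], w x y z, w x' y' z'))"
proof -
  have bool: "{False, True} = UNIV" by auto
  show ?thesis
    by (simp only: behaviour_def set_remdups set_concat set_map bool image_image list.set) auto
qed

lemma ball_cube_3: "(\<forall>a\<in>cube 3. P a) \<longleftrightarrow> (\<forall>x y z. P [x, y, z])"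
  by (auto simp: cube_def numeral_3_eq_3 length_Suc_conv)

lemma ternary_in_constrained: "ternary w \<in> constrained cs \<longleftrightarrow> satisfies (behaviour w) cs"
proof -
  have "ternary w \<in> constrained cs \<longleftrightarrow> (\<forall>(T, R)\<in>set cs. \<forall>x y z x' y' z'.
      cols [x, y, z] [x', y', z'] \<sqsubseteq> T \<longrightarrow> mem R (w x y z) (w x' y' z'))"
    by (simp add: ternary_def constrained_def Omega_def ball_cube_3) (simp add: cube_def)
  also have "\<dots> \<longleftrightarrow> satisfies (behaviour w) cs"
    by (auto simp: satisfies_def list_all_iff ball_behaviour)
  finally show ?thesis .
qed

text \<open>Eleven functions and their negations. The last of the eleven is the majority of
  \<open>x\<close>, \<open>y\<close> and \<open>\<not> z\<close>, self-dual but not monotone, which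
  tells \<open>\<S>\<M>\<close> from the self-dual functions with values 0 and 1 at the
  ends.\<close>

definition separating :: "(bool \<Rightarrow> bool \<Rightarrow> bool \<Rightarrow> bool) list" where
  "separating = concat (map (\<lambda>w. [w, \<lambda>x y z. \<not> w x y z])
    [\<lambda>x y z. False, \<lambda>x y z. x, \<lambda>x y z. x \<and> y, \<lambda>x y z. x \<or> y, \<lambda>x y z. x \<and> \<not> y, \<lambda>x y z. x \<noteq> y,
     \<lambda>x y z. x \<and> y = z, \<lambda>x y z. x \<and> y \<noteq> z, \<lambda>x y z. x \<noteq> y \<and> \<not> z, \<lambda>x y z. x = y \<and> \<not> z,
     \<lambda>x y z. if x = y then x else \<not> z])"

lemma distinct_profiles:
  "distinct (map (\<lambda>cs. map (\<lambda>bs. satisfies bs cs) (map behaviour separating)) listed_constraints)"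
  by code_simp

text \<open>A class determines which of the separating functions it contains, so distinct profiles
  force distinct classes.\<close>

lemma distinct_stable_class_list: "distinct stable_class_list"
proof -
  have "distinct (map (\<lambda>F. map (\<lambda>w. ternary w \<in> F) separating) stable_class_list)"
    using distinct_profiles
    by (simp add: stable_class_list_eq ternary_in_constrained comp_def)
  thus ?thesis by (simp add: distinct_map)
qed

theorem theorem4p1:
  shows "card {F. J_SM_stable F} = 93 \<and>
         {F. J_SM_stable F} = set stable_class_list \<and>
         distinct stable_class_list"
proof -
  have sub: "set stable_class_list \<subseteq> {F. J_SM_stable F}"
    by (auto simp: stable_class_list_eq constrained_stable)
  have "length stable_class_list = 93"
    by (simp add: stable_class_list_def)
  hence card: "card (set stable_class_list) = 93"
    using distinct_card[OF distinct_stable_class_list] by simp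
  \<comment> \<open>A subset with 93 elements of a finite set with at most 93 is the whole set, so
    no candidate has to be matched with its class.\<close>
  with card_stable_le have "set stable_class_list = {F. J_SM_stable F}"
    by (intro card_seteq sub) simp_all
  thus ?thesis using card distinct_stable_class_list by simp
qed

end
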